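(* Let $(X,d)$ and $(Y,\rho)$ be compact metric spaces, let $f_{1,\infty}=\{f_i\}_{i=1}^\infty$ be an equicontinuous sequence of maps from $X$ into itself, and let $g_{1,\infty}=\{g_i\}_{i=1}^\infty$ be an equicontinuous sequence of maps from $Y$ into itself. Suppose $\{\pi_i\}_{i=1}^\infty$ is a semiconjugacy from $(X,f_{1,\infty})$ to $(Y,g_{1,\infty})$ and that there is a finite collection $\{\phi_1,\dots,\phi_k\}$, $k<\infty$, such that $\pi_i\in\{\phi_1,\dots,\phi_k\}$ for every $i\ge1$. Then for any nonempty subset $Z\subseteq X$ and any $\theta\in[0,1]$, \[ \underline{h}_{\mathrm{top}}(f_{1,\infty},Z,\theta)\le \underline{h}_{\mathrm{top}}(g_{1,\infty},\pi_1(Z),\theta)+\max_i\sup_{y\in Y}H\bigl(f_{1,\infty};\pi_i^{-1}(y)\bigr), \] \[ \overline{h}_{\mathrm{top}}(f_{1,\infty},Z,\theta)\le \overline{h}_{\mathrm{top}}(g_{1,\infty},\pi_1(Z),\theta)+\max_i\sup_{y\in Y}H\bigl(f_{1,\infty};\pi_i^{-1}(y)\bigr). \]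
   Context: Intermediate topological entropies. Let $X$ be a compact topological space and $f_{1,\infty}=\{f_i\}_{i=1}^\infty$ a sequence of continuous maps $X\to X$. Put $f_i^0=\mathrm{id}_X$ and $f_i^j=f_{i+j-1}\circ\cdots\circ f_{i+1}\circ f_i$ for $j\ge1$. For a finite open cover $\mathcal U$ of $X$ and $m\in\mathbb N=\{1,2,\dots\}$, a string of length $m(\mathbf U)=m$ is an element $\mathbf U=(U_0,\dots,U_{m-1})\in\mathcal S_m(\mathcal U):=\mathcal U^m$, and $X(\mathbf U)=\{x\in X: f_1^j(x)\in U_j,\ 0\le j\le m-1\}$. For $Z\subseteq X$, $\alpha\ge0$, $\theta\in[0,1]$, $N\in\mathbb N$ let \[ M(Z,\alpha,\mathcal U,N,\theta)=\inf_{\mathcal G}\sum_{\mathbf U\in\mathcal G}e^{-\alpha m(\mathbf U)}, \] the infimum over all finite or countable collections $\mathcal G\subseteq\bigcup_{N\le m<N/\theta+1}\mathcal S_m(\mathcal U)$ with $Z\subseteq\bigcup_{\mathbf U\in\mathcal G}X(\mathbf U)$ (for $\theta=0$, $N/\theta=+\infty$). Let $\underline m(Z,\alpha,\mathcal U,\theta)=\liminf_{N\to\infty}M(Z,\alpha,\mathcal U,N,\theta)$ and $\overline m(Z,\alpha,\mathcal U,\theta)=\limsup_{N\to\infty}M(Z,\alpha,\mathcal U,N,\theta)$. Set $\underline h_{\mathrm{top}}(f_{1,\infty},Z,\mathcal U,\theta)=\inf\{\alpha\ge0:\underline m(Z,\alpha,\mathcal U,\theta)=0\}$, $\overline h_{\mathrm{top}}(f_{1,\infty},Z,\mathcal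 U,\theta)=\inf\{\alpha\ge0:\overline m(Z,\alpha,\mathcal U,\theta)=0\}$. The lower and upper $\theta$-intermediate topological entropies $\underline h_{\mathrm{top}}(f_{1,\infty},Z,\theta)$ and $\overline h_{\mathrm{top}}(f_{1,\infty},Z,\theta)$, with values in $[0,\infty]$, are the suprema of these quantities over all finite open covers $\mathcal U$ of $X$. Equicontinuity: a sequence $\{f_i\}$ of maps between metric spaces is equicontinuous if for each $\varepsilon>0$ there is $\delta>0$ such that points at distance $<\delta$ are mapped by every $f_i$ to points at distance $<\varepsilon$. Semiconjugacy: a sequence $\{\pi_i\}_{i=1}^\infty$ of surjective continuous maps $\pi_i:X\to Y$ with $\pi_{i+1}\circ f_i=g_i\circ\pi_i$ for all $i\ge1$. Topological sup-entropy: for an equicontinuous sequence $f_{1,\infty}$ of self-maps of the compact metric space $(X,d)$ and $n\ge1$ put $d_n^*(x,y)=\sup_{i\ge1}\max_{0\le j<n}d(f_i^j(x),f_i^j(y))$. For nonempty $A\subseteq X$ and $\varepsilon>0$, let $r_n^*(f_{1,\infty};A;\varepsilon)$ be the minimal cardinality of a set $F^*\subseteq X$ such that every $x\in A$ has some $y\in F^*$ with $d_n^*(x,y)\le\varepsilon$. Then $H(f_{1,\infty};A)=\lim_{\varepsilon\to0}\limsup_{n\to\infty}\frac1n\log r_n^*(f_{1,\infty};A;\varepsilon)\in[0,\infty]$. *)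

theory Defs
  imports "HOL-Analysis.Analysis"
begin

text \<open>
  The spaces are types. Sequences of maps are functions on \<open>nat\<close> of which only the values at
  indices \<open>i \<ge> 1\<close> are used. Entropies are extended nonnegative reals.
\<close>

text \<open>\<open>seq_iter f i j\<close> is the composition of the \<open>j\<close> maps \<open>f i, \<dots>, f (i + j - 1)\<close>.\<close>

primrec seq_iter :: "(nat \<Rightarrow> 'a \<Rightarrow> 'a) \<Rightarrow> nat \<Rightarrow> nat \<Rightarrow> 'a \<Rightarrow> 'a" where
  "seq_iter f i 0 = id"
| "seq_iter f i (Suc j) = f (i + j) \<circ> seq_iter f i j"

definition finite_open_cover :: "'a::topological_space set set \<Rightarrow> bool" where
  "finite_open_cover \<U> \<longleftrightarrow> finite \<U> \<and> (\<forall>U\<in>\<U>. open U) \<and> \<Union>\<U> = UNIV"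

definition cover_strings :: "'a set set \<Rightarrow> nat \<Rightarrow> 'a set list set" where
  "cover_strings \<U> m = {Us. length Us = m \<and> set Us \<subseteq> \<U>}"

definition string_set :: "(nat \<Rightarrow> 'a \<Rightarrow> 'a) \<Rightarrow> 'a set list \<Rightarrow> 'a set" where
  "string_set f Us = {x. \<forall>j<length Us. seq_iter f 1 j x \<in> Us ! j}"

text \<open>The case \<open>\<theta> = 0\<close> is separate because \<open>N / 0 = 0\<close> in HOL, whereas here it means \<open>\<infinity>\<close>.\<close>

definition admissible_lengths :: "nat \<Rightarrow> real \<Rightarrow> nat set" where
  "admissible_lengths N \<theta> = {m. N \<le> m \<and> (\<theta> = 0 \<or> real m < real N / \<theta> + 1)}"

definition string_covers ::
  "(nat \<Rightarrow> 'a \<Rightarrow> 'a) \<Rightarrow> 'a set \<Rightarrow> 'a set set \<Rightarrow> nat \<Rightarrow> real \<Rightarrow> 'a set list set set" where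
  "string_covers f Z \<U> N \<theta> =
     {\<G>. countable \<G> \<and> \<G> \<subseteq> (\<Union>m\<in>admissible_lengths N \<theta>. cover_strings \<U> m)
        \<and> Z \<subseteq> (\<Union>Us\<in>\<G>. string_set f Us)}"

definition cover_sum ::
  "(nat \<Rightarrow> 'a \<Rightarrow> 'a) \<Rightarrow> 'a set \<Rightarrow> real \<Rightarrow> 'a set set \<Rightarrow> nat \<Rightarrow> real \<Rightarrow> ennreal" where
  "cover_sum f Z \<alpha> \<U> N \<theta> =
     (INF \<G>\<in>string_covers f Z \<U> N \<theta>. \<Sum>\<^sub>\<infinity>Us\<in>\<G>. ennreal (exp (- \<alpha> * real (length Us))))"

definition lower_cover_sum ::
  "(nat \<Rightarrow> 'a \<Rightarrow> 'a) \<Rightarrow> 'a set \<Rightarrow> real \<Rightarrow> 'a set set \<Rightarrow> real \<Rightarrow> ennreal" where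
  "lower_cover_sum f Z \<alpha> \<U> \<theta> = liminf (\<lambda>N. cover_sum f Z \<alpha> \<U> N \<theta>)"

definition upper_cover_sum ::
  "(nat \<Rightarrow> 'a \<Rightarrow> 'a) \<Rightarrow> 'a set \<Rightarrow> real \<Rightarrow> 'a set set \<Rightarrow> real \<Rightarrow> ennreal" where
  "upper_cover_sum f Z \<alpha> \<U> \<theta> = limsup (\<lambda>N. cover_sum f Z \<alpha> \<U> N \<theta>)"

definition lower_entropy_cover ::
  "(nat \<Rightarrow> 'a \<Rightarrow> 'a) \<Rightarrow> 'a set \<Rightarrow> 'a set set \<Rightarrow> real \<Rightarrow> ennreal" where
  "lower_entropy_cover f Z \<U> \<theta> =
     (INF \<alpha>\<in>{\<alpha>. 0 \<le> \<alpha> \<and> lower_cover_sum f Z \<alpha> \<U> \<theta> = 0}. ennreal \<alpha>)"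

definition upper_entropy_cover ::
  "(nat \<Rightarrow> 'a \<Rightarrow> 'a) \<Rightarrow> 'a set \<Rightarrow> 'a set set \<Rightarrow> real \<Rightarrow> ennreal" where
  "upper_entropy_cover f Z \<U> \<theta> =
     (INF \<alpha>\<in>{\<alpha>. 0 \<le> \<alpha> \<and> upper_cover_sum f Z \<alpha> \<U> \<theta> = 0}. ennreal \<alpha>)"

definition lower_intermediate_entropy ::
  "(nat \<Rightarrow> 'a::topological_space \<Rightarrow> 'a) \<Rightarrow> 'a set \<Rightarrow> real \<Rightarrow> ennreal" where
  "lower_intermediate_entropy f Z \<theta> =
     (SUP \<U>\<in>{\<U>. finite_open_cover \<U>}. lower_entropy_cover f Z \<U> \<theta>)"

definition upper_intermediate_entropy ::
  "(nat \<Rightarrow> 'a::topological_space \<Rightarrow> 'a) \<Rightarrow> 'a set \<Rightarrow> real \<Rightarrow> ennreal" where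
  "upper_intermediate_entropy f Z \<theta> =
     (SUP \<U>\<in>{\<U>. finite_open_cover \<U>}. upper_entropy_cover f Z \<U> \<theta>)"

definition equicontinuous_seq ::
  "(nat \<Rightarrow> 'a::metric_space \<Rightarrow> 'b::metric_space) \<Rightarrow> bool" where
  "equicontinuous_seq f \<longleftrightarrow>
     (\<forall>\<epsilon>>0. \<exists>\<delta>>0. \<forall>i\<ge>1. \<forall>x y. dist x y < \<delta> \<longrightarrow> dist (f i x) (f i y) < \<epsilon>)"

definition semiconjugacy ::
  "(nat \<Rightarrow> 'a::topological_space \<Rightarrow> 'a) \<Rightarrow> (nat \<Rightarrow> 'b::topological_space \<Rightarrow> 'b) \<Rightarrow>
   (nat \<Rightarrow> 'a \<Rightarrow> 'b) \<Rightarrow> bool" where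
  "semiconjugacy f g \<pi> \<longleftrightarrow>
     (\<forall>i\<ge>1. continuous_on UNIV (\<pi> i) \<and> surj (\<pi> i) \<and> \<pi> (Suc i) \<circ> f i = g i \<circ> \<pi> i)"

text \<open>
  On a compact space the distances are bounded, so the real supremum below is a genuine one
  for \<open>n \<ge> 1\<close>.
\<close>

definition sup_dist ::
  "(nat \<Rightarrow> 'a::metric_space \<Rightarrow> 'a) \<Rightarrow> nat \<Rightarrow> 'a \<Rightarrow> 'a \<Rightarrow> real" where
  "sup_dist f n x y =
     (SUP i\<in>{1..}. MAX j\<in>{..<n}. dist (seq_iter f i j x) (seq_iter f i j y))"

text \<open>
  For an equicontinuous sequence on a compact space and \<open>\<epsilon> > 0\<close>, finite spanning sets exist,
  so the minimum is attained.
\<close>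

definition sup_span_number ::
  "(nat \<Rightarrow> 'a::metric_space \<Rightarrow> 'a) \<Rightarrow> nat \<Rightarrow> 'a set \<Rightarrow> real \<Rightarrow> nat" where
  "sup_span_number f n A \<epsilon> =
     (LEAST r. \<exists>F. finite F \<and> card F = r \<and> (\<forall>x\<in>A. \<exists>y\<in>F. sup_dist f n x y \<le> \<epsilon>))"

definition sup_entropy :: "(nat \<Rightarrow> 'a::metric_space \<Rightarrow> 'a) \<Rightarrow> 'a set \<Rightarrow> ennreal" where
  "sup_entropy f A =
     Lim (at_right 0)
       (\<lambda>\<epsilon>. limsup (\<lambda>n. ennreal (ln (real (sup_span_number f n A \<epsilon>)) / real n)))"

end

theory Submission
  imports Defs
begin

text \<open>
  Bowen's covering argument. Fix \<open>c\<close> above all fibre entropies and a scale \<open>\<epsilon>\<close> adapted to the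
  given cover of \<open>X\<close>. Each fibre over \<open>y\<close> has, for a suitable length \<open>n\<close>, a spanning set of at
  most \<open>exp (c n)\<close> points. By compactness this persists over a neighbourhood of \<open>y\<close>, which can be
  chosen to serve all \<open>\<pi> i\<close> at once since there are only finitely many. Finitely many
  such neighbourhoods form a cover \<open>\<V>\<close> of \<open>Y\<close>. Following a string of \<open>\<V>\<close> of length \<open>m\<close> and
  concatenating the spanning sets, one covers its preimage by at most \<open>C exp (c m)\<close> strings
  of \<open>X\<close> of the \<^emph>\<open>same\<close> length \<open>m\<close>; hence the admissible range of lengths, and with it \<open>\<theta>\<close>,
  plays no role.
\<close>

section \<open>Iterates of a non-autonomous system and the metric d_n^*\<close>

lemma seq_iter_add: "seq_iter f i (a + b) x = seq_iter f (i + a) b (seq_iter f i a x)"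
  by (induction b) (auto simp: add.assoc)

lemma semiconjugacy_seq_iter:
  assumes "semiconjugacy f g \<pi>" "i \<ge> 1"
  shows "\<pi> (i + j) (seq_iter f i j x) = seq_iter g i j (\<pi> i x)"
proof (induction j)
  case (Suc j)
  have "\<pi> (Suc (i + j)) \<circ> f (i + j) = g (i + j) \<circ> \<pi> (i + j)"
    using assms by (auto simp: semiconjugacy_def)
  from fun_cong[OF this, of "seq_iter f i j x"] Suc show ?case by simp
qed simp

text \<open>Every factor of the composition obeys the same modulus, so composing \<open>j\<close>
  moduli gives a \<delta> valid for all starting indices \<open>i\<close>. This uniformity matches
  the supremum over \<open>i\<close> in \<open>sup_dist\<close>.\<close>

lemma equicontinuous_seq_iter:
  assumes f: "equicontinuous_seq f" and "\<epsilon> > 0"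
  shows "\<exists>\<delta>>0. \<forall>i\<ge>1. \<forall>x y. dist x y < \<delta> \<longrightarrow> dist (seq_iter f i j x) (seq_iter f i j y) < \<epsilon>"
  using \<open>\<epsilon> > 0\<close>
proof (induction j arbitrary: \<epsilon>)
  case (Suc j)
  obtain \<delta> where \<delta>: "\<delta> > 0" "\<And>i x y. i \<ge> 1 \<Longrightarrow> dist x y < \<delta> \<Longrightarrow> dist (f i x) (f i y) < \<epsilon>"
    using f Suc.prems unfolding equicontinuous_seq_def by metis
  obtain \<delta>' where "\<delta>' > 0"
    "\<And>i x y. i \<ge> 1 \<Longrightarrow> dist x y < \<delta>' \<Longrightarrow> dist (seq_iter f i j x) (seq_iter f i j y) < \<delta>"
    using Suc.IH[OF \<delta>(1)] by metis
  with \<delta> show ?case by (intro exI[of _ \<delta>']) auto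
qed auto

lemma equicontinuous_seq_iter_less:
  assumes f: "equicontinuous_seq f" and "\<epsilon> > 0"
  obtains \<delta> where "\<delta> > 0"
    "\<And>i j x y. i \<ge> 1 \<Longrightarrow> j < n \<Longrightarrow> dist x y < \<delta> \<Longrightarrow>
      dist (seq_iter f i j x) (seq_iter f i j y) < \<epsilon>"
proof -
  obtain d where d: "\<And>j. d j > 0"
    "\<And>i j x y. i \<ge> 1 \<Longrightarrow> dist x y < d j \<Longrightarrow> dist (seq_iter f i j x) (seq_iter f i j y) < \<epsilon>"
    using equicontinuous_seq_iter[OF assms] by metis
  show thesis
  \<comment> \<open>The \<open>1\<close> keeps the set nonempty, so that \<open>Min\<close> is
    meaningful for \<open>n = 0\<close> as well.\<close>
  proof (rule that[of "Min (insert 1 (d ` {..<n}))"])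
    show "Min (insert 1 (d ` {..<n})) > 0"
      using d(1) by (subst Min_gr_iff) auto
    show "dist (seq_iter f i j x) (seq_iter f i j y) < \<epsilon>"
      if "i \<ge> 1" "j < n" "dist x y < Min (insert 1 (d ` {..<n}))" for i j x y
      using that d(2) by (subst (asm) Min_gr_iff) auto
  qed
qed

lemma sup_dist_bounded:
  fixes f :: "nat \<Rightarrow> 'a::metric_space \<Rightarrow> 'a"
  assumes "compact (UNIV :: 'a set)" "n \<ge> 1"
  shows "bdd_above ((\<lambda>i. MAX j\<in>{..<n}. dist (seq_iter f i j x) (seq_iter f i j y)) ` {1..})"
proof -
  obtain B where B: "\<And>x y :: 'a. dist x y \<le> B"
    using compact_imp_bounded[OF assms(1)] by (auto simp: bounded_two_points)
  show ?thesis
    using assms(2) B by (intro bdd_aboveI[of _ B]) (auto simp: lessThan_empty_iff)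
qed

lemma dist_seq_iter_le_sup_dist:
  fixes f :: "nat \<Rightarrow> 'a::metric_space \<Rightarrow> 'a"
  assumes "compact (UNIV :: 'a set)" "i \<ge> 1" "j < n"
  shows "dist (seq_iter f i j x) (seq_iter f i j y) \<le> sup_dist f n x y"
proof -
  have "dist (seq_iter f i j x) (seq_iter f i j y)
      \<le> (MAX j\<in>{..<n}. dist (seq_iter f i j x) (seq_iter f i j y))"
    using assms by (intro Max_ge) auto
  also have "\<dots> \<le> sup_dist f n x y"
    unfolding sup_dist_def using assms by (intro cSUP_upper sup_dist_bounded) auto
  finally show ?thesis .
qed

lemma sup_dist_leI:
  assumes "n \<ge> 1"
    "\<And>i j. i \<ge> 1 \<Longrightarrow> j < n \<Longrightarrow> dist (seq_iter f i j x) (seq_iter f i j y) \<le> \<epsilon>"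
  shows "sup_dist f n x y \<le> \<epsilon>"
  unfolding sup_dist_def using assms
  by (intro cSUP_least) (auto simp: lessThan_empty_iff)

section \<open>Spanning numbers and the sup-entropy\<close>

text \<open>\<open>LEAST\<close> is a genuine minimum once some finite spanning set exists.
  Compactness gives a finite \<delta>-net of the whole space, and equicontinuity makes it spanning
  for every \<open>A\<close>.\<close>

lemma sup_span_number_attained:
  fixes f :: "nat \<Rightarrow> 'a::metric_space \<Rightarrow> 'a"
  assumes X: "compact (UNIV :: 'a set)" and f: "equicontinuous_seq f" and "n \<ge> 1" "\<epsilon> > 0"
  shows "\<exists>F. finite F \<and> card F = sup_span_number f n A \<epsilon> \<and>
    (\<forall>x\<in>A. \<exists>y\<in>F. sup_dist f n x y \<le> \<epsilon>)"
proof -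
  obtain \<delta> where \<delta>: "\<delta> > 0" "\<And>i j x y. i \<ge> 1 \<Longrightarrow> j < n \<Longrightarrow> dist x y < \<delta> \<Longrightarrow>
      dist (seq_iter f i j x) (seq_iter f i j y) < \<epsilon>"
    using equicontinuous_seq_iter_less[OF f \<open>\<epsilon> > 0\<close>] by metis
  have "UNIV \<subseteq> (\<Union>x::'a. ball x \<delta>)" using \<delta>(1) by auto
  from compactE_image[OF X open_ball this]
  obtain F :: "'a set" where F: "finite F" "UNIV \<subseteq> (\<Union>x\<in>F. ball x \<delta>)" .
  have "\<exists>y\<in>F. sup_dist f n x y \<le> \<epsilon>" for x
  proof -
    have "x \<in> (\<Union>x\<in>F. ball x \<delta>)" using F(2) by blast
    then obtain y where "y \<in> F" "dist x y < \<delta>"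
      by (auto simp: dist_commute)
    moreover from this have "sup_dist f n x y \<le> \<epsilon>"
      using \<delta>(2) \<open>n \<ge> 1\<close> by (intro sup_dist_leI) (auto intro: less_imp_le)
    ultimately show ?thesis by auto
  qed
  with F(1) have "\<exists>r F. finite F \<and> card F = r \<and> (\<forall>x\<in>A. \<exists>y\<in>F. sup_dist f n x y \<le> \<epsilon>)"
    by auto
  from LeastI_ex[OF this] show ?thesis unfolding sup_span_number_def .
qed

lemma sup_span_number_antimono:
  fixes f :: "nat \<Rightarrow> 'a::metric_space \<Rightarrow> 'a"
  assumes "compact (UNIV :: 'a set)" "equicontinuous_seq f" "n \<ge> 1" "0 < \<epsilon>" "\<epsilon> \<le> \<epsilon>'"
  shows "sup_span_number f n A \<epsilon>' \<le> sup_span_number f n A \<epsilon>"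
proof -
  obtain F where "finite F" "card F = sup_span_number f n A \<epsilon>"
    "\<forall>x\<in>A. \<exists>y\<in>F. sup_dist f n x y \<le> \<epsilon>"
    using sup_span_number_attained[OF assms(1-4)] by blast
  moreover from this have "\<forall>x\<in>A. \<exists>y\<in>F. sup_dist f n x y \<le> \<epsilon>'"
    using \<open>\<epsilon> \<le> \<epsilon>'\<close> by (meson order_trans)
  ultimately show ?thesis
    unfolding sup_span_number_def[of f n A \<epsilon>'] by (intro Least_le) blast
qed

text \<open>Meant for the limit in \<open>sup_entropy\<close>: the growth rate can only increase as
  the scale shrinks, so the limit at 0 exists and is a supremum.\<close>

lemma tendsto_at_right_SUP_antimono:
  fixes s :: "real \<Rightarrow> ennreal"
  assumes "\<And>x y. a < x \<Longrightarrow> x \<le> y \<Longrightarrow> s y \<le> s x"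
  shows "(s \<longlongrightarrow> (SUP x\<in>{a<..}. s x)) (at_right a)"
proof (rule order_tendstoI)
  fix l assume "l < (SUP x\<in>{a<..}. s x)"
  then obtain x where x: "x > a" "l < s x" by (auto simp: less_SUP_iff)
  show "eventually (\<lambda>y. l < s y) (at_right a)"
    unfolding eventually_at_right_field
    using x assms by (intro exI[of _ x]) (auto intro: less_le_trans)
next
  fix u assume "(SUP x\<in>{a<..}. s x) < u"
  then have "s x < u" if "x > a" for x
    using that by (auto dest: SUP_lessD)
  then show "eventually (\<lambda>y. s y < u) (at_right a)"
    by (intro eventually_at_right_less[THEN eventually_mono])
qed

text \<open>\<open>Lim\<close> is informative only once convergence is shown. Antimonotonicity in
  the scale identifies it with the supremum over \<epsilon> > 0, which bounds the rate at each
  scale.\<close>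

lemma limsup_span_le_sup_entropy:
  fixes f :: "nat \<Rightarrow> 'a::metric_space \<Rightarrow> 'a"
  assumes X: "compact (UNIV :: 'a set)" and f: "equicontinuous_seq f" and "\<epsilon> > 0"
  shows "limsup (\<lambda>n. ennreal (ln (real (sup_span_number f n A \<epsilon>)) / real n)) \<le> sup_entropy f A"
proof -
  define s where
    "s \<epsilon> = limsup (\<lambda>n. ennreal (ln (real (sup_span_number f n A \<epsilon>)) / real n))" for \<epsilon>
  have "s y \<le> s x" if "0 < x" "x \<le> y" for x y
    unfolding s_def
  proof (intro Limsup_mono eventually_sequentiallyI ennreal_leI)
    fix n :: nat assume "n \<ge> 1"
    note le = sup_span_number_antimono[OF X f this that, of A]
    show "ln (real (sup_span_number f n A y)) / real n \<le> ln (real (sup_span_number f n A x)) / real n"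
    proof (cases "sup_span_number f n A y = 0")
      \<comment> \<open>A spanning number 0 means that \<open>A\<close> is empty. HOL sets
        \<open>ln 0 = 0\<close>, and the right-hand side is nonnegative in any case.\<close>
      case True
      then show ?thesis by (cases "sup_span_number f n A x = 0") auto
    next
      case False
      with le show ?thesis by (intro divide_right_mono) auto
    qed
  qed
  then have "(s \<longlongrightarrow> (SUP x\<in>{0<..}. s x)) (at_right 0)"
    by (intro tendsto_at_right_SUP_antimono)
  then have "sup_entropy f A = (SUP x\<in>{0<..}. s x)"
    unfolding sup_entropy_def s_def[symmetric] by (intro tendsto_Lim) auto
  with \<open>\<epsilon> > 0\<close> show ?thesis
    unfolding s_def[symmetric] by (auto intro: SUP_upper)
qed

text \<open>A limsup below \<open>c\<close> forces the rate below \<open>c\<close> for all large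
  \<open>n\<close>, and one such \<open>n\<close> is retained. How large it must be depends on
  \<open>A\<close>, so different fibres get different lengths.\<close>

lemma sup_entropy_less_spanning:
  fixes f :: "nat \<Rightarrow> 'a::metric_space \<Rightarrow> 'a"
  assumes X: "compact (UNIV :: 'a set)" and f: "equicontinuous_seq f" and "\<epsilon> > 0"
    and less: "sup_entropy f A < ennreal c"
  obtains n F where "n \<ge> 1" "finite F" "real (card F) \<le> exp (c * real n)"
    "\<And>x. x \<in> A \<Longrightarrow> \<exists>y\<in>F. sup_dist f n x y \<le> \<epsilon>"
proof -
  \<comment> \<open>\<open>ennreal\<close> truncates nonpositive reals to 0, and nothing lies
    strictly below 0.\<close>
  have "c > 0" using less by (cases "c > 0") (auto simp: ennreal_neg)
  have "eventually (\<lambda>n. ennreal (ln (real (sup_span_number f n A \<epsilon>)) / real n) < ennreal c) sequentially"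
    by (rule Limsup_lessD) (use limsup_span_le_sup_entropy[OF X f \<open>\<epsilon> > 0\<close>] less in \<open>rule le_less_trans\<close>)
  from eventually_happens[OF eventually_conj[OF this eventually_ge_at_top[of 1]]]
  obtain n where n: "n \<ge> 1" "ennreal (ln (real (sup_span_number f n A \<epsilon>)) / real n) < ennreal c"
    by auto
  have "real (sup_span_number f n A \<epsilon>) \<le> exp (c * real n)"
  proof (cases "sup_span_number f n A \<epsilon> = 0")
    case False
    have "ln (real (sup_span_number f n A \<epsilon>)) / real n < c"
      using n(2) \<open>c > 0\<close> by (meson ennreal_leI linorder_not_less)
    then have "ln (real (sup_span_number f n A \<epsilon>)) \<le> c * real n"
      using n(1) by (simp add: field_simps)
    then have "exp (ln (real (sup_span_number f n A \<epsilon>))) \<le> exp (c * real n)" by simp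
    then show ?thesis using False by simp
  qed auto
  with sup_span_number_attained[OF X f n(1) \<open>\<epsilon> > 0\<close>, of A] n(1) show thesis
    by (metis that)
qed

section \<open>Shadowing near fibres and lifting of strings\<close>

text \<open>A tube argument: half of \<epsilon> is spent on moving to the fibre, half on the
  spanning set of the fibre. Shadowing holds from every starting time \<open>i\<close>, as required
  for blocks that begin at arbitrary times.\<close>

lemma fibre_neighbourhood_spanning:
  fixes f :: "nat \<Rightarrow> 'a::metric_space \<Rightarrow> 'a" and p :: "'a \<Rightarrow> 'b::metric_space"
  assumes X: "compact (UNIV :: 'a set)" and f: "equicontinuous_seq f" and "\<epsilon> > 0"
    and p: "continuous_on UNIV p"
    and less: "sup_entropy f (p -` {y}) < ennreal c"
  obtains W n F where "open W" "y \<in> W" "n \<ge> 1" "finite F" "real (card F) \<le> exp (c * real n)"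
    "\<And>x. p x \<in> W \<Longrightarrow>
      \<exists>z\<in>F. \<forall>i\<ge>1. \<forall>j<n. dist (seq_iter f i j x) (seq_iter f i j z) < \<epsilon>"
proof -
  have "\<epsilon> / 2 > 0" using \<open>\<epsilon> > 0\<close> by simp
  obtain n F where n: "n \<ge> 1" and F: "finite F" "real (card F) \<le> exp (c * real n)"
    "\<And>x. x \<in> p -` {y} \<Longrightarrow> \<exists>z\<in>F. sup_dist f n x z \<le> \<epsilon> / 2"
    using sup_entropy_less_spanning[OF X f \<open>\<epsilon> / 2 > 0\<close> less] by metis
  obtain \<delta> where \<delta>: "\<delta> > 0" "\<And>i j x y. i \<ge> 1 \<Longrightarrow> j < n \<Longrightarrow> dist x y < \<delta> \<Longrightarrow>
      dist (seq_iter f i j x) (seq_iter f i j y) < \<epsilon> / 2"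
    using equicontinuous_seq_iter_less[OF f \<open>\<epsilon> / 2 > 0\<close>] by metis
  define Q where "Q = (\<Union>x\<in>p -` {y}. ball x \<delta>)"
  show thesis
  \<comment> \<open>This is the largest set whose preimage lies in \<open>Q\<close>; it is open
    because \<open>p\<close> maps the compact set \<open>- Q\<close> onto a closed one.\<close>
  proof (rule that[of "- p ` (- Q)" n F])
    have "compact (- Q)"
      using X closed_Int_compact[of "- Q" UNIV] by (auto simp: Q_def open_UN closed_Compl)
    then show "open (- p ` (- Q))"
      by (intro open_Compl compact_imp_closed compact_continuous_image continuous_on_subset[OF p]) auto
    show "y \<in> - p ` (- Q)"
      using \<delta>(1) by (force simp: Q_def)
    show "\<exists>z\<in>F. \<forall>i\<ge>1. \<forall>j<n. dist (seq_iter f i j x) (seq_iter f i j z) < \<epsilon>"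
      if "p x \<in> - p ` (- Q)" for x
    proof -
      from that have "x \<in> Q" by blast
      then obtain x' where x': "p x' = y" "dist x x' < \<delta>"
        by (auto simp: Q_def dist_commute)
      then obtain z where z: "z \<in> F" "sup_dist f n x' z \<le> \<epsilon> / 2"
        using F(3)[of x'] by auto
      have "dist (seq_iter f i j x) (seq_iter f i j z) < \<epsilon>" if "i \<ge> 1" "j < n" for i j
        using dist_seq_iter_le_sup_dist[OF X that, of f x' z] \<delta>(2)[OF that x'(2)] z(2)
          dist_triangle[of "seq_iter f i j x" "seq_iter f i j z" "seq_iter f i j x'"] by linarith
      with z(1) show ?thesis by auto
    qed
  qed (use n F(1,2) in auto)
qed

text \<open>A string of \<V> is followed while the factor map \<pi> i changes with time, so one
  cover has to serve every \<open>p\<close>. The block length and the spanning set may still depend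
  on \<open>p\<close> and \<open>V\<close>.\<close>

lemma fibre_cover_spanning:
  fixes f :: "nat \<Rightarrow> 'a::metric_space \<Rightarrow> 'a" and P :: "('a \<Rightarrow> 'b::metric_space) set"
  assumes X: "compact (UNIV :: 'a set)" and Y: "compact (UNIV :: 'b set)"
    and f: "equicontinuous_seq f" and "\<epsilon> > 0" and "finite P"
    and p: "\<forall>p\<in>P. continuous_on UNIV p"
    and less: "\<forall>p\<in>P. \<forall>y. sup_entropy f (p -` {y}) < ennreal c"
  shows "\<exists>\<V> n F. finite_open_cover \<V> \<and>
    (\<forall>p\<in>P. \<forall>V\<in>\<V>. n p V \<ge> (1::nat) \<and> finite (F p V) \<and>
      real (card (F p V)) \<le> exp (c * real (n p V)) \<and>
      (\<forall>x. p x \<in> V \<longrightarrow>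
        (\<exists>z\<in>F p V. \<forall>i\<ge>1. \<forall>j<n p V. dist (seq_iter f i j x) (seq_iter f i j z) < \<epsilon>)))"
proof -
  define Q where "Q p n F V \<longleftrightarrow> n \<ge> 1 \<and> finite F \<and> real (card F) \<le> exp (c * real n) \<and>
    (\<forall>x. p x \<in> V \<longrightarrow> (\<exists>z\<in>F. \<forall>i\<ge>1. \<forall>j<n. dist (seq_iter f i j x) (seq_iter f i j z) < \<epsilon>))"
    for p :: "'a \<Rightarrow> 'b" and n and F :: "'a set" and V
  have Q_subset: "Q p n F V" if "Q p n F W" "V \<subseteq> W" for p n F V W
    using that unfolding Q_def by blast
  have "\<exists>W n F. open W \<and> y \<in> W \<and> Q p n F W" if "p \<in> P" for p y
    using fibre_neighbourhood_spanning[OF X f \<open>\<epsilon> > 0\<close> p[rule_format, OF that] less[rule_format, OF that]]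
    unfolding Q_def by metis
  then obtain W where W: "\<And>p y. p \<in> P \<Longrightarrow> open (W p y) \<and> y \<in> W p y \<and> (\<exists>n F. Q p n F (W p y))"
    by metis
  define V where "V y = (\<Inter>p\<in>P. W p y)" for y
  have V: "open (V y)" "y \<in> V y" for y
    unfolding V_def using W \<open>finite P\<close> by auto
  have "UNIV \<subseteq> (\<Union>y\<in>UNIV. V y)" using V(2) by auto
  from compactE_image[OF Y V(1) this] obtain C where C: "finite C" "UNIV \<subseteq> (\<Union>y\<in>C. V y)" .
  have cov: "finite_open_cover (V ` C)"
    unfolding finite_open_cover_def using C V(1) by auto
  have "\<exists>n F. Q p n F U" if "p \<in> P" "U \<in> V ` C" for p U
  proof -
    obtain y where "U \<subseteq> W p y" using \<open>p \<in> P\<close> \<open>U \<in> V ` C\<close> unfolding V_def by blast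
    with W[OF \<open>p \<in> P\<close>] Q_subset show ?thesis by meson
  qed
  then obtain n F where "\<And>p U. p \<in> P \<Longrightarrow> U \<in> V ` C \<Longrightarrow> Q p (n p U) (F p U) U"
    by metis
  with cov show ?thesis
    unfolding Q_def[symmetric] by (intro exI[of _ "V ` C"] exI[of _ n] exI[of _ F]) simp
qed

text \<open>The itinerary of a point \<open>x\<close> is copied, on each of the blocks into which the string is cut,
  from the orbit of a nearby point of the spanning set; the choice of \<open>u\<close> comes from a Lebesgue
  number, so that one string of \<open>\<U>\<close> serves all \<open>x\<close> shadowed by the same points. The last block
  may stick out of the string, which costs the factor \<open>exp (c B)\<close>.\<close>

lemma string_lift:
  fixes f :: "nat \<Rightarrow> 'a::metric_space \<Rightarrow> 'a" and g :: "nat \<Rightarrow> 'b::metric_space \<Rightarrow> 'b"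
  assumes conj: "semiconjugacy f g \<pi>"
    and P: "\<And>i. i \<ge> 1 \<Longrightarrow> \<pi> i \<in> P"
    and "c \<ge> 0"
    and nF: "\<forall>p\<in>P. \<forall>V\<in>\<V>.
      n p V \<ge> (1::nat) \<and> finite (F p V) \<and> real (card (F p V)) \<le> exp (c * real (n p V)) \<and>
      (\<forall>x. p x \<in> V \<longrightarrow>
        (\<exists>z\<in>F p V. \<forall>i\<ge>1. \<forall>j<n p V. dist (seq_iter f i j x) (seq_iter f i j z) < \<epsilon>))"
    and B: "\<And>p V. p \<in> P \<Longrightarrow> V \<in> \<V> \<Longrightarrow> n p V \<le> B"
    and u: "\<And>x. u x \<in> \<U>" "\<And>x. ball x \<epsilon> \<subseteq> u x"
    and "set Vs \<subseteq> \<V>" "i \<ge> 1"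
  shows "\<exists>G. finite G \<and> G \<subseteq> cover_strings \<U> (length Vs) \<and>
    real (card G) \<le> exp (c * (real (length Vs) + real B)) \<and>
    (\<forall>x. (\<forall>j<length Vs. seq_iter g i j (\<pi> i x) \<in> Vs ! j) \<longrightarrow>
      (\<exists>Us\<in>G. \<forall>j<length Vs. seq_iter f i j x \<in> Us ! j))"
  using \<open>set Vs \<subseteq> \<V>\<close> \<open>i \<ge> 1\<close>
\<comment> \<open>Strong induction, because the length of the block removed varies; \<open>i\<close>
  is generalised because the tail starts at a later time.\<close>
proof (induction "length Vs" arbitrary: Vs i rule: less_induct)
  case less
  show ?case
  proof (cases Vs)
    case Nil
    then show ?thesis
      using \<open>c \<ge> 0\<close> by (intro exI[of _ "{[]}"]) (auto simp: cover_strings_def)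
  next
    case (Cons V Vs')
    define L where "L = length Vs"
    have "V \<in> \<V>" using less.prems Cons by auto
    have "\<pi> i \<in> P" using P less.prems by auto
    note block = nF[rule_format, OF \<open>\<pi> i \<in> P\<close> \<open>V \<in> \<V>\<close>] B[OF \<open>\<pi> i \<in> P\<close> \<open>V \<in> \<V>\<close>]
    define k where "k = n (\<pi> i) V"
    define S where "S = F (\<pi> i) V"
    \<comment> \<open>The first block is truncated where the string ends.\<close>
    define l where "l = min k L"
    define w where "w z = map (\<lambda>j. u (seq_iter f i j z)) [0..<l]" for z
    have k: "k \<ge> 1" "k \<le> B" using block by (auto simp: k_def)
    have S: "finite S" "real (card S) \<le> exp (c * real k)"
      using block by (auto simp: S_def k_def)
    have w: "length (w z) = l" "set (w z) \<subseteq> \<U>" for z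
      using u(1) by (auto simp: w_def)
    have head: "\<exists>z\<in>S. \<forall>j<l. seq_iter f i j x \<in> w z ! j"
      if "\<pi> i x \<in> V" for x
    proof -
      obtain z where "z \<in> S" "\<forall>j<k. dist (seq_iter f i j x) (seq_iter f i j z) < \<epsilon>"
        using block \<open>\<pi> i x \<in> V\<close> less.prems(2) unfolding S_def k_def by blast
      then show ?thesis
        using u(2) by (intro bexI[of _ z]) (force simp: w_def l_def dist_commute subset_iff)+
    qed
    \<comment> \<open>\<open>G'\<close> serves the part of the string after the first block. Its
      size is bounded jointly with that of \<open>S\<close>, so that the factor exp (c B) enters
      once and not at each block.\<close>
    obtain G' where G': "finite G'" "G' \<subseteq> cover_strings \<U> (L - l)"
      "real (card S * card G') \<le> exp (c * (real L + real B))"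
      "\<And>x. (\<forall>j<L - l. seq_iter g (i + l) j (\<pi> (i + l) x) \<in> Vs ! (l + j)) \<Longrightarrow>
        \<exists>Us\<in>G'. \<forall>j<L - l. seq_iter f (i + l) j x \<in> Us ! j"
    proof (cases "k < L")
      case True
      then have "l = k" by (simp add: l_def)
      have "length (drop k Vs) < length Vs" "set (drop k Vs) \<subseteq> \<V>" "i + k \<ge> 1"
        using True k less.prems set_drop_subset[of k Vs] by (auto simp: L_def)
      from less.hyps[OF this] obtain G' where G': "finite G'" "G' \<subseteq> cover_strings \<U> (L - k)"
        "real (card G') \<le> exp (c * (real (L - k) + real B))"
        "\<And>x. (\<forall>j<L - k. seq_iter g (i + k) j (\<pi> (i + k) x) \<in> Vs ! (k + j)) \<Longrightarrow>
          \<exists>Us\<in>G'. \<forall>j<L - k. seq_iter f (i + k) j x \<in> Us ! j"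
        by (auto simp: L_def)
      have "real (card S * card G') \<le> exp (c * real k) * exp (c * (real (L - k) + real B))"
        unfolding of_nat_mult by (intro mult_mono S G') auto
      also have "\<dots> = exp (c * (real L + real B))"
        using True by (simp add: exp_add[symmetric] algebra_simps)
      finally show thesis using G' \<open>l = k\<close> by (intro that) auto
    next
      case False
      \<comment> \<open>The first block reaches the end of the string and the tail is empty. The
        length \<open>k\<close> may exceed \<open>L\<close>; the allowance \<open>B\<close> absorbs
        the excess.\<close>
      have "real (card S) \<le> exp (c * real k)" by (fact S)
      also have "\<dots> \<le> exp (c * (real L + real B))"
        using k \<open>c \<ge> 0\<close> by (auto intro!: mult_left_mono)
      finally show thesis
        using False by (intro that[of "{[]}"]) (auto simp: l_def cover_strings_def)
    qed
    define G where "G = (\<lambda>(z, Us). w z @ Us) ` (S \<times> G')"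
    have "finite G" using S G' by (auto simp: G_def)
    moreover have "G \<subseteq> cover_strings \<U> L"
      using G'(2) w by (fastforce simp: G_def cover_strings_def l_def)
    moreover have "real (card G) \<le> exp (c * (real L + real B))"
    proof -
      have "card G \<le> card S * card G'"
        unfolding G_def using S(1) G'(1) by (metis card_cartesian_product card_image_le finite_SigmaI)
      then show ?thesis using G'(3) by linarith
    qed
    moreover have "\<exists>Us\<in>G. \<forall>j<L. seq_iter f i j x \<in> Us ! j"
      if x: "\<forall>j<L. seq_iter g i j (\<pi> i x) \<in> Vs ! j" for x
    proof -
      have "\<pi> i x \<in> V" using x Cons by (force simp: L_def)
      with head obtain z where z: "z \<in> S" "\<forall>j<l. seq_iter f i j x \<in> w z ! j" by blast
      \<comment> \<open>The tail condition is tested at the point \<open>seq_iter f i l x\<close>: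
        by the semiconjugacy, its image under \<open>\<pi> (i + l)\<close> lies on the orbit of
        \<open>\<pi> i x\<close>.\<close>
      have "\<forall>j<L - l. seq_iter g (i + l) j (\<pi> (i + l) (seq_iter f i l x)) \<in> Vs ! (l + j)"
        using x semiconjugacy_seq_iter[OF conj less.prems(2)]
        by (auto simp: seq_iter_add[symmetric])
      from G'(4)[OF this] obtain Us where Us: "Us \<in> G'"
        "\<forall>j<L - l. seq_iter f i (l + j) x \<in> Us ! j"
        by (auto simp: seq_iter_add)
      have "seq_iter f i j x \<in> (w z @ Us) ! j" if "j < L" for j
      proof (cases "j < l")
        case False
        then show ?thesis
          using Us(2)[rule_format, of "j - l"] that w(1) by (simp add: nth_append)
      qed (use z w(1) in \<open>auto simp: nth_append\<close>)
      with z(1) Us(1) show ?thesis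
        by (intro bexI[of _ "w z @ Us"]) (auto simp: G_def)
    qed
    ultimately show ?thesis unfolding L_def by blast
  qed
qed

section \<open>Sums over covers by strings, and the critical exponent\<close>

text \<open>An infinite sum in \<open>ennreal\<close> is the supremum of its finite partial sums.
  The sets \<open>G t\<close> may overlap, so each \<open>s\<close> is assigned to a single index
  \<open>v s\<close>, and the fibres of \<open>v\<close> partition the finite set.\<close>

lemma infsum_UN_le_ennreal:
  fixes a :: "'b \<Rightarrow> ennreal"
  assumes "\<And>t. t \<in> T \<Longrightarrow> finite (G t)" "\<And>t. t \<in> T \<Longrightarrow> sum a (G t) \<le> K * b t"
  shows "infsum a (\<Union>t\<in>T. G t) \<le> K * infsum b T"
proof -
  have "sum a S \<le> K * infsum b T" if S: "finite S" "S \<subseteq> (\<Union>t\<in>T. G t)" for S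
  proof -
    obtain v where v: "\<And>s. s \<in> S \<Longrightarrow> v s \<in> T \<and> s \<in> G (v s)"
      using S(2) by (metis UN_E subsetD)
    have "sum a S = (\<Sum>t\<in>v ` S. sum a {s \<in> S. v s = t})"
      by (rule sum.image_gen[OF S(1)])
    also have "\<dots> \<le> (\<Sum>t\<in>v ` S. sum a (G t))"
    proof (rule sum_mono)
      fix t assume "t \<in> v ` S"
      with v have "finite (G t)" "{s \<in> S. v s = t} \<subseteq> G t" using assms(1) by blast+
      then show "sum a {s \<in> S. v s = t} \<le> sum a (G t)" by (intro sum_mono2) auto
    qed
    also have "\<dots> \<le> (\<Sum>t\<in>v ` S. K * b t)"
      using v assms(2) by (intro sum_mono) auto
    also have "\<dots> = K * sum b (v ` S)"
      by (simp add: sum_distrib_left)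
    also have "sum b (v ` S) \<le> infsum b T"
      unfolding nonneg_infsum_complete[of T b, simplified]
      using v S(1) by (intro SUP_upper) auto
    finally show ?thesis by (simp add: mult_left_mono)
  qed
  then show ?thesis
    by (subst nonneg_infsum_complete) (auto intro!: SUP_least)
qed

text \<open>Multiplication by a finite constant is continuous and monotone, hence commutes with
  infima of nonempty families. For the empty family both sides are \<open>top\<close>, which needs
  \<open>K > 0\<close>.\<close>

lemma INF_cmult_ennreal:
  fixes b :: "'b \<Rightarrow> ennreal"
  assumes "K > 0"
  shows "(INF t\<in>T. ennreal K * b t) = ennreal K * (INF t\<in>T. b t)"
proof (cases "T = {}")
  case True
  then show ?thesis using assms by (simp add: ennreal_mult_top)
next
  case False
  have "continuous_on UNIV (\<lambda>x. ennreal K * x)"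
    by (intro ennreal_continuous_on_cmult) auto
  then have "continuous (at_right (INF t\<in>T. b t)) (\<lambda>x. ennreal K * x)"
    by (simp add: continuous_on_eq_continuous_at continuous_at_imp_continuous_at_within)
  from continuous_at_Inf_mono[OF _ this] False show ?thesis
    by (simp add: monoI mult_left_mono image_comp)
qed

text \<open>Raising the exponent by \<open>c\<close> pays for replacing one string of length m by at
  most K exp (c m) strings: their total weight is at most K exp (-\<alpha> m). As lengths are
  preserved, the new family is admissible for the same \<open>N\<close> and \<theta>.\<close>

lemma cover_sum_le:
  fixes f :: "nat \<Rightarrow> 'a \<Rightarrow> 'a" and g :: "nat \<Rightarrow> 'b \<Rightarrow> 'b"
  assumes lift: "\<And>Vs. set Vs \<subseteq> \<V> \<Longrightarrow> \<exists>G. finite G \<and> G \<subseteq> cover_strings \<U> (length Vs) \<and>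
      real (card G) \<le> K * exp (c * real (length Vs)) \<and>
      p -` string_set g Vs \<subseteq> (\<Union>Us\<in>G. string_set f Us)"
    and "K > 0"
  shows "cover_sum f Z (\<alpha> + c) \<U> N \<theta> \<le> ennreal K * cover_sum g (p ` Z) \<alpha> \<V> N \<theta>"
proof -
  have "cover_sum f Z (\<alpha> + c) \<U> N \<theta> \<le>
      ennreal K * (\<Sum>\<^sub>\<infinity>Vs\<in>\<G>. ennreal (exp (- \<alpha> * real (length Vs))))"
    if \<G>: "\<G> \<in> string_covers g (p ` Z) \<V> N \<theta>" for \<G>
  proof -
    have \<G>V: "set Vs \<subseteq> \<V>" "length Vs \<in> admissible_lengths N \<theta>" if "Vs \<in> \<G>" for Vs
      using \<G> that by (auto simp: string_covers_def cover_strings_def)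
    have "\<forall>Vs\<in>\<G>. \<exists>G. finite G \<and> G \<subseteq> cover_strings \<U> (length Vs) \<and>
      real (card G) \<le> K * exp (c * real (length Vs)) \<and>
      p -` string_set g Vs \<subseteq> (\<Union>Us\<in>G. string_set f Us)"
      using lift \<G>V(1) by simp
    then obtain G where "\<forall>Vs\<in>\<G>. finite (G Vs) \<and> G Vs \<subseteq> cover_strings \<U> (length Vs) \<and>
      real (card (G Vs)) \<le> K * exp (c * real (length Vs)) \<and>
      p -` string_set g Vs \<subseteq> (\<Union>Us\<in>G Vs. string_set f Us)"
      by (rule bchoice[THEN exE])
    note this[THEN bspec]
    then have G: "finite (G Vs)" "G Vs \<subseteq> cover_strings \<U> (length Vs)"
      "real (card (G Vs)) \<le> K * exp (c * real (length Vs))"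
      "p -` string_set g Vs \<subseteq> (\<Union>Us\<in>G Vs. string_set f Us)" if "Vs \<in> \<G>" for Vs
      using that by simp_all
    have "(\<Union>Vs\<in>\<G>. G Vs) \<in> string_covers f Z \<U> N \<theta>"
      unfolding string_covers_def
    proof (intro CollectI conjI)
      show "countable (\<Union>Vs\<in>\<G>. G Vs)"
        using \<G> G(1) by (auto simp: string_covers_def intro: countable_finite)
      show "(\<Union>Vs\<in>\<G>. G Vs) \<subseteq> (\<Union>m\<in>admissible_lengths N \<theta>. cover_strings \<U> m)"
        using G(2) \<G>V(2) by blast
      show "Z \<subseteq> (\<Union>Us\<in>\<Union>Vs\<in>\<G>. G Vs. string_set f Us)"
      proof
        fix x assume "x \<in> Z"
        then obtain Vs where "Vs \<in> \<G>" "p x \<in> string_set g Vs"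
          using \<G> by (auto simp: string_covers_def)
        with G(4) have "x \<in> (\<Union>Us\<in>G Vs. string_set f Us)" by (meson subsetD vimageI2)
        with \<open>Vs \<in> \<G>\<close> show "x \<in> (\<Union>Us\<in>\<Union>Vs\<in>\<G>. G Vs. string_set f Us)" by auto
      qed
    qed
    then have "cover_sum f Z (\<alpha> + c) \<U> N \<theta> \<le>
        (\<Sum>\<^sub>\<infinity>Us\<in>(\<Union>Vs\<in>\<G>. G Vs). ennreal (exp (- (\<alpha> + c) * real (length Us))))"
      unfolding cover_sum_def by (rule INF_lower)
    also have "\<dots> \<le> ennreal K * (\<Sum>\<^sub>\<infinity>Vs\<in>\<G>. ennreal (exp (- \<alpha> * real (length Vs))))"
    proof (rule infsum_UN_le_ennreal)
      fix Vs assume Vs: "Vs \<in> \<G>"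
      let ?m = "real (length Vs)"
      have "(\<Sum>Us\<in>G Vs. ennreal (exp (- (\<alpha> + c) * real (length Us))))
          = (\<Sum>Us\<in>G Vs. ennreal (exp (- (\<alpha> + c) * ?m)))"
        using G(2)[OF Vs] by (intro sum.cong) (auto simp: cover_strings_def)
      also have "\<dots> = ennreal (real (card (G Vs)) * exp (- (\<alpha> + c) * ?m))"
        by (simp add: ennreal_mult ennreal_of_nat_eq_real_of_nat)
      also have "\<dots> \<le> ennreal (K * exp (c * ?m) * exp (- (\<alpha> + c) * ?m))"
        using G(3)[OF Vs] by (intro ennreal_leI mult_right_mono) auto
      also have "K * exp (c * ?m) * exp (- (\<alpha> + c) * ?m) = K * exp (- \<alpha> * ?m)"
        by (simp add: exp_add[symmetric] algebra_simps)
      also have "ennreal \<dots> = ennreal K * ennreal (exp (- \<alpha> * ?m))"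
        using \<open>K > 0\<close> by (simp add: ennreal_mult)
      finally show "(\<Sum>Us\<in>G Vs. ennreal (exp (- (\<alpha> + c) * real (length Us)))) \<le>
        ennreal K * ennreal (exp (- \<alpha> * ?m))" .
    qed (use G(1) in auto)
    finally show ?thesis .
  qed
  then have "cover_sum f Z (\<alpha> + c) \<U> N \<theta> \<le> (INF \<G>\<in>string_covers g (p ` Z) \<V> N \<theta>.
      ennreal K * (\<Sum>\<^sub>\<infinity>Vs\<in>\<G>. ennreal (exp (- \<alpha> * real (length Vs)))))"
    by (rule INF_greatest)
  then show ?thesis
    by (simp only: INF_cmult_ennreal[OF \<open>K > 0\<close>] cover_sum_def)
qed

text \<open>\<open>K\<close> is independent of \<open>N\<close>, so it passes through liminf and
  limsup and cannot spoil a vanishing limit. Every exponent \<alpha> admissible for \<open>g\<close>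
  thus yields the exponent \<alpha> + c for \<open>f\<close>.\<close>

lemma cover_sum_le_imp_entropy_cover_le:
  assumes le: "\<And>\<alpha> N. cover_sum f Z (\<alpha> + c) \<U> N \<theta> \<le> ennreal K * cover_sum g Z' \<alpha> \<V> N \<theta>"
    and "c \<ge> 0"
  shows "lower_entropy_cover f Z \<U> \<theta> \<le> lower_entropy_cover g Z' \<V> \<theta> + ennreal c"
    and "upper_entropy_cover f Z \<U> \<theta> \<le> upper_entropy_cover g Z' \<V> \<theta> + ennreal c"
proof -
  have K: "continuous_on UNIV (\<lambda>x. ennreal K * x)" "mono (\<lambda>x. ennreal K * x)"
    by (auto intro!: ennreal_continuous_on_cmult monoI mult_left_mono)
  have "lower_cover_sum f Z (\<alpha> + c) \<U> \<theta> \<le> ennreal K * lower_cover_sum g Z' \<alpha> \<V> \<theta>"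
    and "upper_cover_sum f Z (\<alpha> + c) \<U> \<theta> \<le> ennreal K * upper_cover_sum g Z' \<alpha> \<V> \<theta>" for \<alpha>
    unfolding lower_cover_sum_def upper_cover_sum_def
    using le by (auto simp flip: Liminf_compose_continuous_mono[OF K] Limsup_compose_continuous_mono[OF K]
        intro!: Liminf_mono Limsup_mono)
  then have zero: "lower_cover_sum g Z' \<alpha> \<V> \<theta> = 0 \<Longrightarrow> lower_cover_sum f Z (\<alpha> + c) \<U> \<theta> = 0"
    "upper_cover_sum g Z' \<alpha> \<V> \<theta> = 0 \<Longrightarrow> upper_cover_sum f Z (\<alpha> + c) \<U> \<theta> = 0" for \<alpha>
    by (metis le_zero_eq mult_zero_right)+
  \<comment> \<open>Stated for abstract predicates so that it applies to the lower and the upper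
    version alike.\<close>
  have INF_add: "(INF \<alpha>\<in>{\<alpha>. 0 \<le> \<alpha> \<and> P \<alpha>}. ennreal \<alpha>) \<le> (INF \<alpha>\<in>{\<alpha>. 0 \<le> \<alpha> \<and> Q \<alpha>}. ennreal \<alpha>) + ennreal c"
    if PQ: "\<And>\<alpha>. Q \<alpha> \<Longrightarrow> P (\<alpha> + c)" for P Q :: "real \<Rightarrow> bool"
  proof (rule ennreal_le_epsilon)
    fix e :: real
    let ?I = "INF \<alpha>\<in>{\<alpha>. 0 \<le> \<alpha> \<and> Q \<alpha>}. ennreal \<alpha>"
    assume "?I + ennreal c < top" "0 < e"
    \<comment> \<open>The infimum need not be attained, so an exponent within \<open>e\<close> of it
      is chosen. Adding \<open>e\<close> is a strict increase only below \<open>top\<close>, whence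
      the finiteness condition.\<close>
    have "a < a + ennreal e" if "a < top" for a
      using ennreal_add_left_cancel_less[of a 0 "ennreal e"] that \<open>0 < e\<close> by auto
    moreover have "?I < top"
      using \<open>?I + ennreal c < top\<close> unfolding ennreal_add_less_top by simp
    ultimately have "?I < ?I + ennreal e" by blast
    then obtain \<alpha> where \<alpha>: "0 \<le> \<alpha>" "Q \<alpha>" "ennreal \<alpha> < ?I + ennreal e"
      by (auto simp only: INF_less_iff mem_Collect_eq)
    have "(INF \<alpha>\<in>{\<alpha>. 0 \<le> \<alpha> \<and> P \<alpha>}. ennreal \<alpha>) \<le> ennreal (\<alpha> + c)"
      using \<alpha> PQ \<open>c \<ge> 0\<close> by (intro INF_lower) auto
    also have "\<dots> = ennreal \<alpha> + ennreal c"
      using \<alpha> \<open>c \<ge> 0\<close> by simp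
    also have "\<dots> \<le> (INF \<alpha>\<in>{\<alpha>. 0 \<le> \<alpha> \<and> Q \<alpha>}. ennreal \<alpha>) + ennreal e + ennreal c"
      using \<alpha>(3) by (intro add_right_mono) auto
    finally show "(INF \<alpha>\<in>{\<alpha>. 0 \<le> \<alpha> \<and> P \<alpha>}. ennreal \<alpha>)
        \<le> (INF \<alpha>\<in>{\<alpha>. 0 \<le> \<alpha> \<and> Q \<alpha>}. ennreal \<alpha>) + ennreal c + ennreal e"
      by (simp add: ac_simps)
  qed
  show "lower_entropy_cover f Z \<U> \<theta> \<le> lower_entropy_cover g Z' \<V> \<theta> + ennreal c"
    and "upper_entropy_cover f Z \<U> \<theta> \<le> upper_entropy_cover g Z' \<V> \<theta> + ennreal c"
    unfolding lower_entropy_cover_def upper_entropy_cover_def by (rule INF_add, erule zero)+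
qed

section \<open>Comparison of entropies for single covers, and the theorem\<close>

lemma entropy_cover_le:
  fixes f :: "nat \<Rightarrow> 'a::metric_space \<Rightarrow> 'a" and g :: "nat \<Rightarrow> 'b::metric_space \<Rightarrow> 'b"
  assumes X: "compact (UNIV :: 'a set)" and Y: "compact (UNIV :: 'b set)"
    and f: "equicontinuous_seq f" and conj: "semiconjugacy f g \<pi>"
    and fin: "finite (\<pi> ` {1..})"
    and less: "\<And>i y. i \<ge> 1 \<Longrightarrow> sup_entropy f (\<pi> i -` {y}) < ennreal c"
    and \<U>: "finite_open_cover \<U>"
  obtains \<V> where "finite_open_cover \<V>"
    "lower_entropy_cover f Z \<U> \<theta> \<le> lower_entropy_cover g (\<pi> 1 ` Z) \<V> \<theta> + ennreal c"
    "upper_entropy_cover f Z \<U> \<theta> \<le> upper_entropy_cover g (\<pi> 1 ` Z) \<V> \<theta> + ennreal c"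
proof -
  have "c \<ge> 0" using less[of 1] by (cases "c \<ge> 0") (auto simp: ennreal_neg)
  \<comment> \<open>\<epsilon> is a Lebesgue number of \<U>, and \<open>u\<close> picks a member of
    \<U> containing the \<epsilon>-ball around each point.\<close>
  obtain \<epsilon> where "\<epsilon> > 0" "\<And>x. \<exists>U\<in>\<U>. ball x \<epsilon> \<subseteq> U"
    using Heine_Borel_lemma[OF X, of \<U>] \<U> by (auto simp: finite_open_cover_def)
  then obtain u where u: "\<And>x. u x \<in> \<U>" "\<And>x. ball x \<epsilon> \<subseteq> u x" by metis
  have cont: "\<forall>p\<in>\<pi> ` {1..}. continuous_on UNIV p"
    using conj by (auto simp: semiconjugacy_def)
  have less': "\<forall>p\<in>\<pi> ` {1..}. \<forall>y. sup_entropy f (p -` {y}) < ennreal c"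
    using less by auto
  obtain \<V> n F where \<V>: "finite_open_cover \<V>" and nF: "\<forall>p\<in>\<pi> ` {1..}. \<forall>V\<in>\<V>.
      n p V \<ge> (1::nat) \<and> finite (F p V) \<and> real (card (F p V)) \<le> exp (c * real (n p V)) \<and>
      (\<forall>x. p x \<in> V \<longrightarrow>
        (\<exists>z\<in>F p V. \<forall>i\<ge>1. \<forall>j<n p V. dist (seq_iter f i j x) (seq_iter f i j z) < \<epsilon>))"
    using fibre_cover_spanning[OF X Y f \<open>\<epsilon> > 0\<close> fin cont less']
    by (elim exE conjE)
  \<comment> \<open>The longest block; finitely many maps and finitely many members of \<V> make it
    finite. The \<open>0\<close> guards \<open>Max\<close> against an empty set.\<close>
  define B where "B = Max (insert 0 ((\<lambda>(p, V). n p V) ` (\<pi> ` {1..} \<times> \<V>)))"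
  have "finite \<V>" using \<V> by (simp add: finite_open_cover_def)
  then have B: "n p V \<le> B" if "p \<in> \<pi> ` {1..}" "V \<in> \<V>" for p V
    unfolding B_def using that fin by (intro Max_ge) auto
  have "\<exists>G. finite G \<and> G \<subseteq> cover_strings \<U> (length Vs) \<and>
      real (card G) \<le> exp (c * real B) * exp (c * real (length Vs)) \<and>
      \<pi> 1 -` string_set g Vs \<subseteq> (\<Union>Us\<in>G. string_set f Us)" if Vs: "set Vs \<subseteq> \<V>" for Vs
  proof -
    obtain G where G: "finite G" "G \<subseteq> cover_strings \<U> (length Vs)"
      "real (card G) \<le> exp (c * (real (length Vs) + real B))"
      "\<And>x. (\<forall>j<length Vs. seq_iter g 1 j (\<pi> 1 x) \<in> Vs ! j) \<Longrightarrow>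
        \<exists>Us\<in>G. \<forall>j<length Vs. seq_iter f 1 j x \<in> Us ! j"
      using string_lift[OF conj _ \<open>c \<ge> 0\<close> nF B u Vs order_refl] by auto
    have "length Us = length Vs" if "Us \<in> G" for Us
      using G(2) that by (auto simp: cover_strings_def)
    with G(4) have "\<pi> 1 -` string_set g Vs \<subseteq> (\<Union>Us\<in>G. string_set f Us)"
      by (fastforce simp: string_set_def)
    with G show ?thesis
      by (intro exI[of _ G]) (auto simp: distrib_left exp_add mult.commute)
  qed
  \<comment> \<open>The constant \<open>K\<close> is exp (c B), the price of the block that sticks
    out.\<close>
  from cover_sum_le[where p = "\<pi> 1", OF this] have
    "cover_sum f Z (\<alpha> + c) \<U> N \<theta> \<le> ennreal (exp (c * real B)) * cover_sum g (\<pi> 1 ` Z) \<alpha> \<V> N \<theta>"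
    for \<alpha> N by simp
  from cover_sum_le_imp_entropy_cover_le[OF this \<open>c \<ge> 0\<close>] \<V> show thesis
    by (intro that)
qed

theorem theorem4p6:
  fixes f :: "nat \<Rightarrow> 'a::metric_space \<Rightarrow> 'a"
    and g :: "nat \<Rightarrow> 'b::metric_space \<Rightarrow> 'b"
    and \<pi> \<phi> :: "nat \<Rightarrow> 'a \<Rightarrow> 'b"
    and k :: nat
    and Z :: "'a set"
    and \<theta> :: real
  assumes "compact (UNIV :: 'a set)"
    and "compact (UNIV :: 'b set)"
    and "equicontinuous_seq f"
    and "equicontinuous_seq g"
    and "semiconjugacy f g \<pi>"
    and "\<forall>i\<ge>1. \<pi> i \<in> \<phi> ` {1..k}"
    and "Z \<noteq> {}"
    and "\<theta> \<in> {0..1}"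
  shows "lower_intermediate_entropy f Z \<theta> \<le>
           lower_intermediate_entropy g (\<pi> 1 ` Z) \<theta> +
           (MAX i\<in>{1..}. SUP y. sup_entropy f (\<pi> i -` {y})) \<and>
         upper_intermediate_entropy f Z \<theta> \<le>
           upper_intermediate_entropy g (\<pi> 1 ` Z) \<theta> +
           (MAX i\<in>{1..}. SUP y. sup_entropy f (\<pi> i -` {y}))"
proof -
  let ?h = "MAX i\<in>{1..}. SUP y. sup_entropy f (\<pi> i -` {y})"
  have fin: "finite (\<pi> ` {1..})"
    by (rule finite_subset[of _ "\<phi> ` {1..k}"]) (use assms(6) in auto)
  \<comment> \<open>The \<open>MAX\<close> is indexed by an infinite set, but \<pi> takes finitely
    many values there, so it is the maximum of a finite set of suprema.\<close>
  then have "finite ((\<lambda>p. SUP y. sup_entropy f (p -` {y})) ` \<pi> ` {1..})" by (rule finite_imageI)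
  then have h: "sup_entropy f (\<pi> i -` {y}) \<le> ?h" if "i \<ge> 1" for i y
    using that by (intro order_trans[OF SUP_upper[of y UNIV] Max_ge]) (auto simp: image_image)
  have le: "lower_intermediate_entropy f Z \<theta> \<le>
      lower_intermediate_entropy g (\<pi> 1 ` Z) \<theta> + ?h + ennreal e \<and>
    upper_intermediate_entropy f Z \<theta> \<le>
      upper_intermediate_entropy g (\<pi> 1 ` Z) \<theta> + ?h + ennreal e"
    if "?h < top" "e > 0" for e
  proof -
    obtain h where "h \<ge> 0" "?h = ennreal h"
      using \<open>?h < top\<close> by (cases ?h rule: ennreal_cases) auto
    \<comment> \<open>The covering argument needs a real number strictly above all fibre entropies;
      h + e is one, and \<open>e\<close> is arbitrary.\<close>
    then have c: "?h + ennreal e = ennreal (h + e)" using \<open>e > 0\<close> by simp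
    have less: "sup_entropy f (\<pi> i -` {y}) < ennreal (h + e)" if "i \<ge> 1" for i y
      using h[OF that, of y] \<open>?h = ennreal h\<close> \<open>h \<ge> 0\<close> \<open>e > 0\<close>
      by (auto intro: le_less_trans simp: ennreal_less_iff)
    have "lower_entropy_cover f Z \<U> \<theta> \<le>
        lower_intermediate_entropy g (\<pi> 1 ` Z) \<theta> + ennreal (h + e) \<and>
      upper_entropy_cover f Z \<U> \<theta> \<le>
        upper_intermediate_entropy g (\<pi> 1 ` Z) \<theta> + ennreal (h + e)"
      if \<U>: "finite_open_cover \<U>" for \<U>
    proof -
      obtain \<V> where \<V>: "finite_open_cover \<V>"
        "lower_entropy_cover f Z \<U> \<theta> \<le> lower_entropy_cover g (\<pi> 1 ` Z) \<V> \<theta> + ennreal (h + e)"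
        "upper_entropy_cover f Z \<U> \<theta> \<le> upper_entropy_cover g (\<pi> 1 ` Z) \<V> \<theta> + ennreal (h + e)"
        using entropy_cover_le[OF assms(1-3,5) fin less \<U>] by metis
      have "lower_entropy_cover g (\<pi> 1 ` Z) \<V> \<theta> \<le> lower_intermediate_entropy g (\<pi> 1 ` Z) \<theta>"
        "upper_entropy_cover g (\<pi> 1 ` Z) \<V> \<theta> \<le> upper_intermediate_entropy g (\<pi> 1 ` Z) \<theta>"
        unfolding lower_intermediate_entropy_def upper_intermediate_entropy_def
        using \<V>(1) by (auto intro: SUP_upper)
      with \<V>(2,3) show ?thesis by (meson add_right_mono order_trans)
    qed
    then show ?thesis
      unfolding add.assoc c
      by (auto intro!: SUP_least
          simp: lower_intermediate_entropy_def[of f] upper_intermediate_entropy_def[of f])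
  qed
  show ?thesis
  \<comment> \<open>\<open>ennreal_le_epsilon\<close> allows the right-hand side to be assumed
    finite, which makes \<open>?h\<close> finite.\<close>
  proof (intro conjI; rule ennreal_le_epsilon)
    fix e :: real assume "lower_intermediate_entropy g (\<pi> 1 ` Z) \<theta> + ?h < top" "e > 0"
    then have "?h < top" unfolding ennreal_add_less_top by blast
    from le[OF this \<open>e > 0\<close>] show "lower_intermediate_entropy f Z \<theta> \<le>
      lower_intermediate_entropy g (\<pi> 1 ` Z) \<theta> + ?h + ennreal e" by (rule conjunct1)
  next
    fix e :: real assume "upper_intermediate_entropy g (\<pi> 1 ` Z) \<theta> + ?h < top" "e > 0"
    then have "?h < top" unfolding ennreal_add_less_top by blast
    from le[OF this \<open>e > 0\<close>] show "upper_intermediate_entropy f Z \<theta> \<le>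
      upper_intermediate_entropy g (\<pi> 1 ` Z) \<theta> + ?h + ennreal e" by (rule conjunct2)
  qed
qed

end
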